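(* Let $\alpha,\theta>0$, $p\in(0,1)$, let $\{N(t),\,t\ge0\}$ be a Bell-Touchard process with parameters $(\alpha,\theta)$, and let $\{N_1(t),\,t\ge0\}$ be a decomposition of $\{N(t),\,t\ge0\}$ with rate $p$. Then for every $t\ge0$ and $k\in\mathbb{N}_0$, $$\Pr[N_1(t)=k]=\frac{(p\theta)^k}{k!}\exp\{-\alpha t\,\widetilde\theta\,(e^{p\theta}-1)\}\,B_k(\alpha t\,\widetilde\theta),\qquad \widetilde\theta:=e^{(1-p)\theta}.$$
   Context: $\mathbb{N}=\{1,2,\dots\}$, $\mathbb{N}_0=\mathbb{N}\cup\{0\}$. For $n\in\mathbb{N}_0$, $x\in\mathbb{R}$, the Bell polynomial is $B_n(x)=e^{-x}\sum_{k=0}^{\infty}\frac{k^n}{k!}x^k$ (with $0^0=1$). A counting process $\{N(t),t\ge0\}$ is an $\mathbb{N}_0$-valued stochastic process where $N(t)$ is the number of events that have occurred up to time $t$ (so it is nondecreasing in $t$). A function $f:\mathbb{R}\to\mathbb{R}$ is $o(s)$ if $\lim_{s\to0}f(s)/s=0$. A counting process is a Bell-Touchard process with parameters $(\alpha,\theta)$, $\alpha,\theta>0$, if (1) $N(0)=0$; (2) it has stationary and independent increments; (3) $\Pr[N(t+s)-N(t)=k]=\alpha s\,\theta^k/k!+o(s)$ for every $k\in\mathbb{N}$ and $s,t>0$. Decomposition with rate $p$: each event counted by $N$ is classified, independently of all other events and of the process $N$, as type I with probability $p$ or type II with probability $1-p$; $N_1(t)$ denotes the number of type I events up to time $t$ (so,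 given $N(t)=n$, $N_1(t)$ is binomial with parameters $n,p$). *)

theory Defs
  imports "HOL-Probability.Probability"
begin

text \<open>
  Bell (Touchard) polynomial as a function of a real argument, given by Dobinski's series.
  In Isabelle \<open>0 ^ 0 = 1\<close>, as the convention for the term \<open>k = 0\<close>, \<open>n = 0\<close> requires.
\<close>

definition bell_poly :: "nat \<Rightarrow> real \<Rightarrow> real" where
  "bell_poly n x = exp (- x) * (\<Sum>k. real k ^ n / fact k * x ^ k)"

text \<open>
  Processes are indexed by \<open>real\<close>; only the values at times \<open>t \<ge> 0\<close> are constrained.
  Truncated subtraction is harmless in the increments below, because the paths of a counting
  process are nondecreasing.
\<close>

locale counting_process = prob_space M for M :: "'a measure" +
  fixes N :: "real \<Rightarrow> 'a \<Rightarrow> nat"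
  assumes measurable_N: "\<And>t. 0 \<le> t \<Longrightarrow> N t \<in> measurable M (count_space UNIV)"
    and nondecreasing: "\<And>s t \<omega>. 0 \<le> s \<Longrightarrow> s \<le> t \<Longrightarrow> \<omega> \<in> space M \<Longrightarrow> N s \<omega> \<le> N t \<omega>"

locale bell_touchard_process = counting_process M N
  for M :: "'a measure" and N :: "real \<Rightarrow> 'a \<Rightarrow> nat" +
  fixes \<alpha> \<theta> :: real
  assumes pos: "0 < \<alpha>" "0 < \<theta>"
    and start: "\<And>\<omega>. \<omega> \<in> space M \<Longrightarrow> N 0 \<omega> = 0"
    and stationary_increments:
      "\<And>t u s. 0 \<le> t \<Longrightarrow> 0 \<le> u \<Longrightarrow> 0 \<le> s \<Longrightarrow>
         distr M (count_space UNIV) (\<lambda>\<omega>. N (t + s) \<omega> - N t \<omega>) =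
         distr M (count_space UNIV) (\<lambda>\<omega>. N (u + s) \<omega> - N u \<omega>)"
    and independent_increments:
      "\<And>(n :: nat) (\<tau> :: nat \<Rightarrow> real). 0 \<le> \<tau> 0 \<Longrightarrow> strict_mono_on {..n} \<tau> \<Longrightarrow>
         indep_vars (\<lambda>_. count_space UNIV) (\<lambda>i \<omega>. N (\<tau> (Suc i)) \<omega> - N (\<tau> i) \<omega>) {..<n}"
    and infinitesimal:
      "\<And>(k :: nat) t. 1 \<le> k \<Longrightarrow> 0 < t \<Longrightarrow>
         (\<lambda>s. prob {\<omega> \<in> space M. N (t + s) \<omega> - N t \<omega> = k} - \<alpha> * s * (\<theta> ^ k / fact k))
           \<in> o[at_right 0](\<lambda>s. s)"

text \<open>
  The events counted by \<open>N\<close> are numbered \<open>0, 1, 2, \<dots>\<close> in order of occurrence (simultaneous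
  events in some fixed order), so that those up to time \<open>t\<close> are exactly the events
  \<open>i < N t \<omega>\<close>. The mark \<open>\<xi> i\<close> says that event \<open>i\<close> is of type I. The marks are i.i.d. and,
  jointly, independent of the whole process: the sigma-algebra they generate is independent of the
  one generated by all \<open>N s\<close>, \<open>s \<ge> 0\<close>. (The library's \<open>indep_var\<close> needs both variables
  to have the same value type, so this is stated with \<open>indep_set\<close>.)
\<close>

definition decomposition ::
  "'a measure \<Rightarrow> real \<Rightarrow> (real \<Rightarrow> 'a \<Rightarrow> nat) \<Rightarrow> (real \<Rightarrow> 'a \<Rightarrow> nat) \<Rightarrow> bool" where
  "decomposition M p N N\<^sub>1 \<longleftrightarrow>
     (\<exists>\<xi> :: nat \<Rightarrow> 'a \<Rightarrow> bool.
        prob_space.indep_vars M (\<lambda>_. count_space UNIV) \<xi> UNIV \<and>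
        (\<forall>i. measure M {\<omega> \<in> space M. \<xi> i \<omega>} = p) \<and>
        prob_space.indep_set M
          (sigma_sets (space M) {{\<omega> \<in> space M. N s \<omega> \<in> A} | s A. 0 \<le> s})
          (sigma_sets (space M) (range (\<lambda>i. {\<omega> \<in> space M. \<xi> i \<omega>}))) \<and>
        (\<forall>t\<ge>0. \<forall>\<omega>\<in>space M. N\<^sub>1 t \<omega> = card {i. i < N t \<omega> \<and> \<xi> i \<omega>}))"

end

theory Submission
  imports Defs "HOL-Complex_Analysis.Cauchy_Integral_Formula" "HOL-Real_Asymp.Real_Asymp"
begin

text \<open>
  The proof works with probability generating functions \<open>G(z) = E z\<^sup>X\<close> on \<open>[0, 1]\<close>.

  The law of \<open>N t\<close>. By stationarity and independence of the increments, the generating function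
  of \<open>N t\<close> is the \<open>n\<close>-th power of that of \<open>N (t / n)\<close>, for every \<open>n\<close>. The infinitesimal
  condition gives \<open>n P(N (t / n) = k) \<longlonglongrightarrow> \<alpha> t \<theta>\<^sup>k / k!\<close> for each single \<open>k \<ge> 1\<close>, but says
  nothing about uniformity in \<open>k\<close>, nor about \<open>k = 0\<close>. What closes this gap is that
  \<open>P(N t = 0) > 0\<close> (\<open>prob_no_event_pos\<close>): otherwise every increment would be at least \<open>1\<close> almost
  surely, however short, and \<open>N t\<close> would be infinite. Hence \<open>P(N (t / n) = 0) = exp (l / n)\<close> with
  \<open>l = ln P(N t = 0)\<close> finite, which both gives the limit for \<open>k = 0\<close> and bounds all the numbers
  \<open>n P(N (t / n) = k)\<close>, \<open>k \<ge> 1\<close>, by \<open>- l\<close>. Tannery's theorem then allows passing to the limit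
  term by term for \<open>z < 1\<close> (\<open>pgf_of_infinitely_divisible\<close>), with the result
  \<open>exp (l + \<alpha> t (exp (\<theta> z) - 1))\<close>. Letting \<open>z\<close> tend to \<open>1\<close> determines \<open>l\<close>, because total mass
  is \<open>1\<close>; so \<open>N t\<close> has generating function \<open>exp (\<alpha> t (exp (\<theta> z) - exp \<theta>))\<close> (\<open>pgf_process\<close>).

  Thinning. Given \<open>N t = n\<close>, the number of type I events is a sum of \<open>n\<close> independent marks, with
  generating function \<open>(1 - p + p z)\<^sup>n\<close>; so thinning substitutes \<open>1 - p + p z\<close> for \<open>z\<close>
  (\<open>pgf_decomposition\<close>). Writing \<open>x = \<alpha> t exp ((1 - p) \<theta>)\<close>, the generating function of \<open>N\<^sub>1 t\<close>
  becomes \<open>exp (x (exp (p \<theta> z) - exp (p \<theta>)))\<close>.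

  Coefficients. The function \<open>exp (x (exp y - 1))\<close> is the exponential generating function of the
  Bell polynomials (\<open>bell_poly_exponential_sums\<close>). With \<open>y = p \<theta> z\<close> it differs from the generating
  function of \<open>N\<^sub>1 t\<close> by the factor \<open>exp (- x (exp (p \<theta>) - 1))\<close>, and the claimed formula is
  obtained by comparing coefficients of \<open>z\<^sup>k\<close> (\<open>power_series_unique\<close>).
\<close>

section \<open>Generating functions\<close>

definition law :: "'a measure \<Rightarrow> ('a \<Rightarrow> nat) \<Rightarrow> nat pmf" where
  "law M X = Abs_pmf (distr M (count_space UNIV) X)"

definition pgf :: "nat pmf \<Rightarrow> real \<Rightarrow> real" where
  "pgf P z = measure_pmf.expectation P (\<lambda>n. z ^ n)"

text \<open>
  The natural numbers are countable, so the values of probability zero form a null set; this is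
  what makes the distribution a probability mass function.
\<close>

lemma measure_pmf_law:
  assumes "prob_space M" and X: "X \<in> measurable M (count_space UNIV)"
  shows "measure_pmf (law M X) = distr M (count_space UNIV) X"
proof -
  interpret prob_space M by fact
  let ?D = "distr M (count_space UNIV) X"
  interpret D: prob_space ?D by (rule prob_space_distr) (rule X)
  have "AE x in ?D. measure ?D {y} = 0 \<longrightarrow> x \<noteq> y" for y
  proof (cases "measure ?D {y} = 0")
    case True
    then have "{y} \<in> null_sets ?D"
      by (auto simp: null_sets_def D.emeasure_eq_measure)
    then show ?thesis
      by (rule AE_I'[of "{y}"]) auto
  qed simp
  then have "AE x in ?D. \<forall>y. measure ?D {y} = 0 \<longrightarrow> x \<noteq> y"
    by (subst AE_all_countable) blast
  then have "AE x in ?D. measure ?D {x} \<noteq> 0"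
    by eventually_elim blast
  then show ?thesis
    unfolding law_def by (subst Abs_pmf_inverse) (auto simp: D.prob_space_axioms)
qed

lemma pmf_law:
  assumes "prob_space M" and X: "X \<in> measurable M (count_space UNIV)"
  shows "pmf (law M X) n = measure M {\<omega> \<in> space M. X \<omega> = n}"
  using X by (simp add: pmf.rep_eq measure_pmf_law[OF assms] measure_distr vimage_def)
     (rule arg_cong[where f = "measure M"], auto)

lemma pgf_law:
  assumes "prob_space M" and X: "X \<in> measurable M (count_space UNIV)"
  shows "pgf (law M X) z = (\<integral>\<omega>. z ^ X \<omega> \<partial>M)"
  unfolding pgf_def measure_pmf_law[OF assms] by (rule integral_distr[OF X]) simp

lemma integrable_pmf_power:
  fixes z :: real
  assumes "\<bar>z\<bar> \<le> 1"
  shows "integrable (measure_pmf P) (\<lambda>n. z ^ n)"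
  by (rule measure_pmf.integrable_const_bound[where B = 1])
     (use assms in \<open>auto simp: power_abs power_le_one\<close>)

lemma pgf_nonneg: "0 \<le> z \<Longrightarrow> 0 \<le> pgf P z"
  unfolding pgf_def by (rule Bochner_Integration.integral_nonneg) simp

lemma pgf_le_1:
  assumes "0 \<le> z" "z \<le> 1"
  shows "pgf P z \<le> 1"
  unfolding pgf_def
  by (rule measure_pmf.integral_le_const) (use assms in \<open>auto simp: integrable_pmf_power power_le_one\<close>)

lemma ennreal_pgf:
  assumes "0 \<le> z" "z \<le> 1"
  shows "ennreal (pgf P z) = (\<integral>\<^sup>+n. ennreal (z ^ n) \<partial>measure_pmf P)"
  unfolding pgf_def using assms
  by (intro nn_integral_eq_integral[symmetric] integrable_pmf_power) auto

lemma pgf_sums: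
  assumes "\<bar>z\<bar> \<le> 1"
  shows "(\<lambda>n. pmf P n * z ^ n) sums pgf P z"
proof -
  have "integrable (density (count_space UNIV) (pmf P)) (\<lambda>n. z ^ n)"
    using integrable_pmf_power[OF assms] by (simp add: measure_pmf_eq_density)
  then have "integrable (count_space UNIV) (\<lambda>n. pmf P n * z ^ n)"
    by (subst (asm) integrable_density) auto
  from sums_integral_count_space_nat[OF this] show ?thesis
    unfolding pgf_def measure_pmf_eq_density by (subst integral_density) auto
qed

lemma pgf_0: "pgf P 0 = pmf P 0"
  using pgf_sums[of 0 P] sums_unique2 powser_sums_zero by fastforce

text \<open>
  Lets a constant factor of a generating function known only on \<open>[0, 1)\<close> be found by normalization.
\<close>

lemma pgf_left_limit_1: "(\<lambda>n. pgf P (1 - 1 / real (Suc n))) \<longlonglongrightarrow> 1"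
proof -
  have lim: "(\<lambda>n. 1 - 1 / real (Suc n)) \<longlonglongrightarrow> 1"
    using tendsto_diff[OF tendsto_const[of "1::real"] LIMSEQ_inverse_real_of_nat] by (simp add: field_simps)
  have bd: "\<bar>1 - 1 / real (Suc n)\<bar> \<le> 1" for n
    by (simp add: divide_simps)
  have "(\<lambda>n. pgf P (1 - 1 / real (Suc n))) \<longlonglongrightarrow> measure_pmf.expectation P (\<lambda>k. 1 ^ k)"
    unfolding pgf_def
  proof (rule integral_dominated_convergence[where w = "\<lambda>_. 1"])
    show "AE k in measure_pmf P. (\<lambda>n. (1 - 1 / real (Suc n)) ^ k) \<longlonglongrightarrow> 1 ^ k"
      by (intro AE_pmfI tendsto_power lim)
    show "AE k in measure_pmf P. norm ((1 - 1 / real (Suc n)) ^ k) \<le> 1" for n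
      unfolding real_norm_def power_abs using bd[of n] by (intro AE_pmfI power_le_one) auto
  qed auto
  then show ?thesis by simp
qed

lemma pgf_bind:
  assumes "0 \<le> z" "z \<le> 1"
  shows "pgf (bind_pmf P Q) z = measure_pmf.expectation P (\<lambda>n. pgf (Q n) z)"
proof -
  have int: "integrable (measure_pmf P) (\<lambda>n. pgf (Q n) z)"
    using assms
    by (intro measure_pmf.integrable_const_bound[where B = 1] AE_pmfI)
       (auto simp: pgf_nonneg pgf_le_1)
  have "ennreal (pgf (bind_pmf P Q) z) = (\<integral>\<^sup>+n. ennreal (pgf (Q n) z) \<partial>measure_pmf P)"
    using assms by (simp add: ennreal_pgf)
  also have "\<dots> = ennreal (measure_pmf.expectation P (\<lambda>n. pgf (Q n) z))"
    using assms int by (intro nn_integral_eq_integral) (auto simp: pgf_nonneg)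
  finally show ?thesis
    using assms by (subst (asm) ennreal_inj) (auto simp: pgf_nonneg)
qed

text \<open>
  Generating functions are known here only at positive arguments. That suffices, because the zeros
  of a nonzero power series do not accumulate at the origin.
\<close>

lemma power_series_unique:
  fixes a b :: "nat \<Rightarrow> real"
  assumes a: "\<And>z. 0 < z \<Longrightarrow> z < 1 \<Longrightarrow> (\<lambda>n. a n * z ^ n) sums f z"
    and b: "\<And>z. 0 < z \<Longrightarrow> z < 1 \<Longrightarrow> (\<lambda>n. b n * z ^ n) sums f z"
  shows "a = b"
proof (rule ccontr)
  assume "a \<noteq> b"
  then obtain m where m: "a m \<noteq> b m" by blast
  \<comment> \<open>The extra factor \<open>z\<close> makes the series vanish at the point \<open>0\<close> too.\<close>
  define d where "d n = (case n of 0 \<Rightarrow> 0 | Suc i \<Rightarrow> a i - b i)" for n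
  have d: "(\<lambda>n. d n * z ^ n) sums 0" if "0 < z" "z < 1" for z
  proof -
    have "(\<lambda>n. z * (a n * z ^ n - b n * z ^ n)) sums (z * (f z - f z))"
      by (intro sums_mult sums_diff a b that)
    then have "(\<lambda>n. d (Suc n) * z ^ Suc n) sums 0"
      by (simp add: d_def algebra_simps)
    then show ?thesis by (subst (asm) sums_Suc_iff) (simp add: d_def)
  qed
  have "summable (\<lambda>n. d n * x ^ n)" if "norm x < 1" for x
  proof (rule powser_inside)
    show "summable (\<lambda>n. d n * ((1 + norm x) / 2) ^ n)"
      using that norm_ge_zero[of x] by (intro sums_summable[OF d]) (simp_all add: add_pos_nonneg)
    show "norm x < norm ((1 + norm x) / 2)"
      using that by simp
  qed
  then have sm: "(\<lambda>n. d n * (x - 0) ^ n) sums (\<Sum>n. d n * x ^ n)" if "norm (x - 0) < 1" for x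
    using that by (simp add: summable_sums)
  obtain s where s: "0 < s"
    and nz: "\<And>z. z \<in> cball 0 s - {0} \<Longrightarrow> (\<Sum>n. d n * z ^ n) \<noteq> 0"
    by (rule powser_0_nonzero[of 1 0 d "\<lambda>x. \<Sum>n. d n * x ^ n" "Suc m"])
       (use sm m in \<open>auto simp: d_def\<close>)
  define z where "z = min s (1 / 2)"
  have "0 < z" "z < 1" "z \<in> cball 0 s - {0}" using s by (auto simp: z_def)
  then show False using nz[of z] sums_unique[OF d[of z]] by simp
qed

section \<open>Limits of powers of generating functions\<close>

text \<open>
  Compare \<open>a n\<close> with \<open>exp (c / n)\<close>, whose \<open>n\<close>-th power is \<open>exp c\<close>: both bases lie in the unit
  disc, so their \<open>n\<close>-th powers differ by at most \<open>n\<close> times the difference of the bases.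
\<close>

lemma tendsto_exp_from_power:
  fixes a :: "nat \<Rightarrow> real"
  assumes bd: "\<And>n. \<bar>a n\<bar> \<le> 1"
    and lim: "(\<lambda>n. real n * (a n - 1)) \<longlonglongrightarrow> c" and c: "c \<le> 0"
  shows "(\<lambda>n. a n ^ n) \<longlonglongrightarrow> exp c"
proof -
  have exp_lim: "(\<lambda>n. real n * (exp (c / real n) - 1)) \<longlonglongrightarrow> c"
    by real_asymp
  have "(\<lambda>n. a n ^ n - exp c) \<longlonglongrightarrow> 0"
  proof (rule Lim_null_comparison)
    show "(\<lambda>n. \<bar>real n * (a n - 1) - real n * (exp (c / real n) - 1)\<bar>) \<longlonglongrightarrow> 0"
      using tendsto_rabs[OF tendsto_diff[OF lim exp_lim]] by simp
    show "\<forall>\<^sub>F n in sequentially. norm (a n ^ n - exp c) \<le>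
        \<bar>real n * (a n - 1) - real n * (exp (c / real n) - 1)\<bar>"
      using eventually_gt_at_top[of 0]
    proof eventually_elim
      case (elim n)
      have "exp c = exp (c / real n) ^ n"
        using elim by (simp add: exp_of_nat_mult[symmetric])
      moreover have "norm (a n ^ n - exp (c / real n) ^ n) \<le> n * norm (a n - exp (c / real n))"
        using bd[of n] c by (intro norm_power_diff) (auto simp: divide_nonpos_nonneg)
      ultimately show ?case
        by (simp add: right_diff_distrib[symmetric] abs_mult)
    qed
  qed
  then show ?thesis by (simp add: LIM_zero_iff)
qed

text \<open>
  A law \<open>P\<close> that is an \<open>n\<close>-fold convolution power for every \<open>n\<close> and charges \<open>0\<close> is compound
  Poisson, with jump rates \<open>r\<close>. The limits of the single point masses of the roots \<open>Q n\<close> suffice: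
  all mass of \<open>Q n\<close> away from \<open>0\<close> is \<open>1 - exp (l / n)\<close>, hence at most \<open>- l / n\<close>, where
  \<open>l = ln P(0)\<close>, and this gives a geometric dominating series for each \<open>z < 1\<close>. At \<open>z = 1\<close> there
  is no such majorant.
\<close>

lemma pgf_of_infinitely_divisible:
  fixes P :: "nat pmf" and Q :: "nat \<Rightarrow> nat pmf"
  assumes root: "\<And>n z. 0 < n \<Longrightarrow> 0 \<le> z \<Longrightarrow> z \<le> 1 \<Longrightarrow> pgf P z = pgf (Q n) z ^ n"
    and pos: "0 < pmf P 0"
    and rate: "\<And>k. 0 < k \<Longrightarrow> (\<lambda>n. real n * pmf (Q n) k) \<longlonglongrightarrow> r k"
    and z: "0 \<le> z" "z < 1"
  shows "pgf P z = exp (ln (pmf P 0) + (\<Sum>k. r (Suc k) * z ^ Suc k))"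
proof -
  define l where "l = ln (pmf P 0)"
  have l: "l \<le> 0" using pos by (simp add: l_def pmf_le_1)
  have Q0: "pmf (Q n) 0 = exp (l / real n)" if "0 < n" for n
  proof -
    have "pmf (Q n) 0 ^ n = exp (l / real n) ^ n"
      using root[of n 0] that pos by (simp add: pgf_0 exp_of_nat_mult[symmetric] l_def)
    then show ?thesis using that power_eq_imp_eq_base[of "pmf (Q n) 0" n] by simp
  qed
  have bound: "real n * pmf (Q n) (Suc k) \<le> - l" for n k
  proof (cases "n = 0")
    case False
    have "pmf (Q n) 0 + pmf (Q n) (Suc k) = measure_pmf.prob (Q n) {0, Suc k}"
      by (subst measure_measure_pmf_finite) auto
    also have "\<dots> \<le> 1" by simp
    finally have "pmf (Q n) (Suc k) \<le> 1 - exp (l / real n)" using Q0[of n] False by simp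
    also have "\<dots> \<le> - (l / real n)" using exp_ge_add_one_self[of "l / real n"] by linarith
    finally show ?thesis using False by (simp add: field_simps)
  qed (use l in simp)
  have split: "real n * (pgf (Q n) z - 1) =
      real n * (pmf (Q n) 0 - 1) + (\<Sum>k. real n * pmf (Q n) (Suc k) * z ^ Suc k)" for n
  proof -
    have "(\<lambda>k. pmf (Q n) k * z ^ k) sums pgf (Q n) z" using z by (intro pgf_sums) auto
    then have "(\<lambda>k. pmf (Q n) (Suc k) * z ^ Suc k) sums (pgf (Q n) z - pmf (Q n) 0)"
      by (subst sums_Suc_iff) simp
    from sums_unique[OF sums_mult[OF this, of "real n"]] show ?thesis
      by (simp add: algebra_simps)
  qed
  have lim0: "(\<lambda>n. real n * (pmf (Q n) 0 - 1)) \<longlonglongrightarrow> l"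
  proof (rule Lim_transform_eventually)
    show "(\<lambda>n. real n * (exp (l / real n) - 1)) \<longlonglongrightarrow> l" by real_asymp
    show "\<forall>\<^sub>F n in sequentially. real n * (exp (l / real n) - 1) = real n * (pmf (Q n) 0 - 1)"
      using eventually_gt_at_top[of 0] by eventually_elim (simp add: Q0)
  qed
  have lim1: "(\<lambda>n. \<Sum>k. real n * pmf (Q n) (Suc k) * z ^ Suc k)
      \<longlonglongrightarrow> (\<Sum>k. r (Suc k) * z ^ Suc k)"
  proof (rule tannerys_theorem[THEN conjunct2, THEN conjunct2])
    show "(\<lambda>n. real n * pmf (Q n) (Suc k) * z ^ Suc k) \<longlonglongrightarrow> r (Suc k) * z ^ Suc k" for k
      by (intro tendsto_mult rate tendsto_const) simp
    show "\<forall>\<^sub>F (k, n) in sequentially \<times>\<^sub>F sequentially.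
        norm (real n * pmf (Q n) (Suc k) * z ^ Suc k) \<le> - l * z ^ Suc k"
    proof (intro always_eventually allI, clarify)
      fix k n
      have "norm (real n * pmf (Q n) (Suc k) * z ^ Suc k) = real n * pmf (Q n) (Suc k) * z ^ Suc k"
        using z by (simp add: abs_mult)
      also have "\<dots> \<le> - l * z ^ Suc k" using z by (intro mult_right_mono bound) auto
      finally show "norm (real n * pmf (Q n) (Suc k) * z ^ Suc k) \<le> - l * z ^ Suc k" .
    qed
    show "summable (\<lambda>k. - l * z ^ Suc k)"
      using z by (intro summable_mult summable_mult2 summable_geometric iffD2[OF summable_Suc_iff]) auto
  qed simp
  let ?c = "l + (\<Sum>k. r (Suc k) * z ^ Suc k)"
  have lim: "(\<lambda>n. real n * (pgf (Q n) z - 1)) \<longlonglongrightarrow> ?c"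
    unfolding split by (rule tendsto_add[OF lim0 lim1])
  have "?c \<le> 0"
    using z pgf_le_1[of z] by (intro LIMSEQ_le_const2[OF lim]) (auto simp: mult_nonneg_nonpos)
  then have "(\<lambda>n. pgf (Q n) z ^ n) \<longlonglongrightarrow> exp ?c"
    using z lim by (intro tendsto_exp_from_power) (auto simp: pgf_nonneg pgf_le_1)
  moreover have "(\<lambda>n. pgf (Q n) z ^ n) \<longlonglongrightarrow> pgf P z"
    by (rule tendsto_eventually)
       (use z root in \<open>auto intro!: eventually_mono[OF eventually_gt_at_top[of 0]]\<close>)
  ultimately show ?thesis unfolding l_def by (rule LIMSEQ_unique[symmetric])
qed

section \<open>The law of the Bell-Touchard process\<close>

context bell_touchard_process
begin

lemma increment_measurable:
  assumes "0 \<le> s" "0 \<le> t"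
  shows "(\<lambda>\<omega>. N t \<omega> - N s \<omega>) \<in> measurable M (count_space UNIV)"
proof -
  note [measurable] = measurable_N[OF assms(1)] measurable_N[OF assms(2)]
  show ?thesis by measurable
qed

lemma law_increment:
  assumes "0 \<le> t" "0 \<le> s"
  shows "law M (\<lambda>\<omega>. N (t + s) \<omega> - N t \<omega>) = law M (N s)"
proof -
  have "distr M (count_space UNIV) (\<lambda>\<omega>. N (0 + s) \<omega> - N 0 \<omega>) = distr M (count_space UNIV) (N s)"
    by (rule distr_cong) (auto simp: start)
  then show ?thesis
    using stationary_increments[of t 0 s] assms by (simp add: law_def)
qed

text \<open>
  Monotone paths are needed: with truncated subtraction the sum telescopes only then.
\<close>

lemma sum_increments:
  assumes "\<omega> \<in> space M" "0 \<le> h"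
  shows "(\<Sum>i<n. N (h * real (Suc i)) \<omega> - N (h * real i) \<omega>) = N (h * real n) \<omega>"
proof (induction n)
  case 0
  show ?case using start[OF assms(1)] by simp
next
  case (Suc n)
  have "N (h * real n) \<omega> \<le> N (h * real (Suc n)) \<omega>"
    using assms by (intro nondecreasing) (auto intro!: mult_left_mono)
  then show ?case using Suc by simp
qed

lemma pgf_power:
  assumes h: "0 < h" and z: "\<bar>z\<bar> \<le> 1"
  shows "pgf (law M (N (h * real n))) z = pgf (law M (N h)) z ^ n"
proof -
  let ?I = "\<lambda>i \<omega>. N (h * real (Suc i)) \<omega> - N (h * real i) \<omega>"
  have I_meas: "?I i \<in> measurable M (count_space UNIV)" for i
    using h by (intro increment_measurable) auto
  have "pgf (law M (N (h * real n))) z = (\<integral>\<omega>. z ^ N (h * real n) \<omega> \<partial>M)"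
    using h by (intro pgf_law measurable_N prob_space_axioms) auto
  also have "\<dots> = (\<integral>\<omega>. (\<Prod>i<n. z ^ ?I i \<omega>) \<partial>M)"
    using h by (intro Bochner_Integration.integral_cong refl)
      (simp add: power_sum[symmetric] sum_increments del: of_nat_Suc)
  also have "\<dots> = (\<Prod>i<n. \<integral>\<omega>. z ^ ?I i \<omega> \<partial>M)"
  proof (rule indep_vars_lebesgue_integral)
    have "indep_vars (\<lambda>_. count_space UNIV) ?I {..<n}"
      using h independent_increments[of "\<lambda>i. h * real i" n]
      by (auto simp: strict_mono_on_def)
    then show "indep_vars (\<lambda>_. borel) (\<lambda>i \<omega>. z ^ ?I i \<omega>) {..<n}"
      by (rule indep_vars_compose2[where Y = "\<lambda>_ k. z ^ k"]) simp
    show "integrable M (\<lambda>\<omega>. z ^ ?I i \<omega>)" for i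
      using z I_meas[of i] 
      by (intro integrable_const_bound[where B = 1] measurable_compose[OF I_meas])
         (auto simp: power_abs power_le_one)
  qed simp
  also have "\<dots> = (\<Prod>i<n. pgf (law M (N h)) z)"
  proof (rule prod.cong[OF refl])
    fix i
    have "law M (?I i) = law M (N h)"
      using law_increment[of "h * real i" h] h by (simp add: algebra_simps)
    then show "(\<integral>\<omega>. z ^ ?I i \<omega> \<partial>M) = pgf (law M (N h)) z"
      using pgf_law[OF prob_space_axioms I_meas[of i], of z] by simp
  qed
  finally show ?thesis by simp
qed

text \<open>
  Suppose that \<open>N t\<close> is almost surely nonzero. The probability that \<open>N t\<close> vanishes is the \<open>n\<close>-th
  power of the probability that \<open>N (t / n)\<close> does, so each of \<open>n\<close> equal pieces of the time interval
  almost surely contains an event. Then \<open>N t\<close> exceeds every \<open>n\<close>, which is absurd.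
\<close>

lemma prob_no_event_pos:
  assumes t: "0 < t"
  shows "0 < pmf (law M (N t)) 0"
proof (rule ccontr)
  assume "\<not> ?thesis"
  then have 0: "pmf (law M (N t)) 0 = 0" by (simp add: not_less pmf_nonneg antisym)
  have "AE \<omega> in M. n \<le> N t \<omega>" for n
  proof (cases "n = 0")
    case False
    define h where "h = t / real n"
    have h: "0 < h" "h * real n = t" using t False by (auto simp: h_def)
    let ?I = "\<lambda>i \<omega>. N (h * real (Suc i)) \<omega> - N (h * real i) \<omega>"
    have "pmf (law M (N h)) 0 ^ n = 0"
      using pgf_power[of h 0 n] h 0 by (simp add: pgf_0)
    then have h0: "pmf (law M (N h)) 0 = 0" by simp
    have "AE \<omega> in M. 1 \<le> ?I i \<omega>" for i
    proof -
      have I_meas: "?I i \<in> measurable M (count_space UNIV)"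
        using h by (intro increment_measurable) auto
      have "prob {\<omega> \<in> space M. ?I i \<omega> = 0} = 0"
        using law_increment[of "h * real i" h] h h0 pmf_law[OF prob_space_axioms I_meas, of 0]
        by (simp add: algebra_simps)
      moreover have "{\<omega> \<in> space M. ?I i \<omega> = 0} \<in> events"
        using measurable_sets[OF I_meas, of "{0}"] by (simp add: vimage_def Int_def conj_commute)
      ultimately have "AE \<omega> in M. \<not> (?I i \<omega> = 0)"
        by (subst AE_iff_measurable[OF _ refl]) (auto simp: emeasure_eq_measure)
      then show ?thesis by eventually_elim simp
    qed
    then have "AE \<omega> in M. \<forall>i. 1 \<le> ?I i \<omega>" by (subst AE_all_countable) blast
    with AE_space show ?thesis
    proof eventually_elim
      case (elim \<omega>)
      have "n = (\<Sum>i<n. 1)" by simp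
      also have "\<dots> \<le> (\<Sum>i<n. ?I i \<omega>)" by (rule sum_mono) (use elim in blast)
      also have "\<dots> = N t \<omega>" using sum_increments[of \<omega> h n] elim h by simp
      finally show ?case .
    qed
  qed simp
  then have "AE \<omega> in M. \<forall>n. n \<le> N t \<omega>" by (subst AE_all_countable) blast
  then have "AE \<omega> in M. False" by eventually_elim (metis Suc_n_not_le_n)
  then show False by simp
qed

text \<open>
  The increments start from time \<open>1\<close> because the infinitesimal condition speaks about positive
  times only; stationarity carries the result over to time \<open>0\<close>.
\<close>

lemma small_time_rate:
  assumes t: "0 < t" and k: "0 < k"
  shows "(\<lambda>n. real n * pmf (law M (N (t / real n))) k) \<longlonglongrightarrow> \<alpha> * t * (\<theta> ^ k / fact k)"
proof -
  let ?f = "\<lambda>s. prob {\<omega> \<in> space M. N (1 + s) \<omega> - N 1 \<omega> = k} - \<alpha> * s * (\<theta> ^ k / fact k)"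
  have "((\<lambda>s. ?f s / s) \<longlongrightarrow> 0) (at_right 0)"
    using infinitesimal[of k 1] k by (intro smalloD_tendsto) auto
  moreover have "filterlim (\<lambda>n. t / real n) (at_right 0) sequentially"
    using t by real_asymp
  ultimately have "(\<lambda>n. ?f (t / real n) / (t / real n)) \<longlonglongrightarrow> 0"
    by (rule filterlim_compose)
  then have "(\<lambda>n. t * (?f (t / real n) / (t / real n)) + \<alpha> * t * (\<theta> ^ k / fact k))
      \<longlonglongrightarrow> t * 0 + \<alpha> * t * (\<theta> ^ k / fact k)"
    by (intro tendsto_intros)
  moreover have "\<forall>\<^sub>F n in sequentially. t * (?f (t / real n) / (t / real n)) +
      \<alpha> * t * (\<theta> ^ k / fact k) = real n * pmf (law M (N (t / real n))) k"
    using eventually_gt_at_top[of 0]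
  proof eventually_elim
    case (elim n)
    have "pmf (law M (N (t / real n))) k =
        prob {\<omega> \<in> space M. N (1 + t / real n) \<omega> - N 1 \<omega> = k}"
      using pmf_law[OF prob_space_axioms increment_measurable[of 1 "1 + t / real n"], of k]
        law_increment[of 1 "t / real n"] t by simp
    then show ?case using elim t by (simp add: field_simps)
  qed
  ultimately show ?thesis by (simp add: filterlim_cong)
qed

lemma pgf_process:
  assumes t: "0 \<le> t" and z: "0 \<le> z" "z < 1"
  shows "pgf (law M (N t)) z = exp (\<alpha> * t * (exp (\<theta> * z) - exp \<theta>))"
proof (cases "t = 0")
  case True
  have "pgf (law M (N 0)) z = (\<integral>\<omega>. z ^ N 0 \<omega> \<partial>M)"
    by (intro pgf_law measurable_N prob_space_axioms) auto
  also have "\<dots> = (\<integral>\<omega>. 1 \<partial>M)"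
    by (intro Bochner_Integration.integral_cong) (auto simp: start)
  finally show ?thesis using True by (simp add: prob_space)
next
  case False
  then have t: "0 < t" using t by simp
  define l where "l = ln (pmf (law M (N t)) 0)"
  have exp_series: "(\<Sum>k. \<alpha> * t * (\<theta> ^ Suc k / fact (Suc k)) * x ^ Suc k) =
      \<alpha> * t * (exp (\<theta> * x) - 1)" for x
  proof -
    have "(\<lambda>k. (\<theta> * x) ^ k /\<^sub>R fact k) sums exp (\<theta> * x)" by (rule exp_converges)
    then have "(\<lambda>k. (\<theta> * x) ^ Suc k /\<^sub>R fact (Suc k)) sums (exp (\<theta> * x) - 1)"
      by (subst sums_Suc_iff) simp
    from sums_mult[OF this, of "\<alpha> * t"] show ?thesis
      by (intro sums_unique[symmetric])
        (simp add: power_mult_distrib divide_inverse mult_ac del: power_Suc fact_Suc)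
  qed
  \<comment> \<open>The exponent contains the unknown \<open>l\<close>; the limit \<open>x \<longlonglongrightarrow> 1\<close> below determines it.\<close>
  have pgf: "pgf (law M (N t)) x = exp (l + \<alpha> * t * (exp (\<theta> * x) - 1))"
    if "0 \<le> x" "x < 1" for x
  proof -
    have "pgf (law M (N t)) x = exp (ln (pmf (law M (N t)) 0) +
        (\<Sum>k. \<alpha> * t * (\<theta> ^ Suc k / fact (Suc k)) * x ^ Suc k))"
    proof (rule pgf_of_infinitely_divisible[OF _ prob_no_event_pos[OF t] small_time_rate[OF t] that])
      fix n :: nat and y :: real
      assume "0 < n" "0 \<le> y" "y \<le> 1"
      then show "pgf (law M (N t)) y = pgf (law M (N (t / real n))) y ^ n"
        using pgf_power[of "t / real n" y n] t by simp
    qed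
    then show ?thesis by (simp only: exp_series l_def)
  qed
  have "(\<lambda>n. exp (l + \<alpha> * t * (exp (\<theta> * (1 - 1 / real (Suc n))) - 1)))
      \<longlonglongrightarrow> exp (l + \<alpha> * t * (exp (\<theta> * (1 - 0)) - 1))"
    by (intro tendsto_intros) (use LIMSEQ_inverse_real_of_nat in \<open>simp add: field_simps\<close>)
  moreover have "(\<lambda>n. exp (l + \<alpha> * t * (exp (\<theta> * (1 - 1 / real (Suc n))) - 1))) \<longlonglongrightarrow> 1"
    using pgf_left_limit_1[of "law M (N t)"] by (subst (asm) pgf) auto
  ultimately have "exp (l + \<alpha> * t * (exp \<theta> - 1)) = 1"
    using LIMSEQ_unique by fastforce
  then have "l = - (\<alpha> * t * (exp \<theta> - 1))" by simp
  then show ?thesis using pgf[OF z] by (simp add: algebra_simps)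
qed

end

section \<open>Thinning\<close>

lemma (in prob_space) pgf_count_marks:
  fixes \<xi> :: "nat \<Rightarrow> 'a \<Rightarrow> bool"
  assumes indep: "indep_vars (\<lambda>_. count_space UNIV) \<xi> UNIV"
    and p: "\<And>i. prob {\<omega> \<in> space M. \<xi> i \<omega>} = p"
    and C: "(\<lambda>\<omega>. card {i. i < n \<and> \<xi> i \<omega>}) \<in> measurable M (count_space UNIV)"
  shows "pgf (law M (\<lambda>\<omega>. card {i. i < n \<and> \<xi> i \<omega>})) z = (1 - p + p * z) ^ n"
proof -
  have [measurable]: "\<xi> i \<in> measurable M (count_space UNIV)" for i
    using indep by (auto simp: indep_vars_def)
  have "pgf (law M (\<lambda>\<omega>. card {i. i < n \<and> \<xi> i \<omega>})) z =
      (\<integral>\<omega>. z ^ card {i. i < n \<and> \<xi> i \<omega>} \<partial>M)"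
    by (rule pgf_law[OF prob_space_axioms C])
  also have "\<dots> = (\<integral>\<omega>. (\<Prod>i<n. if \<xi> i \<omega> then z else 1) \<partial>M)"
  proof (intro Bochner_Integration.integral_cong refl)
    fix \<omega>
    have "{i \<in> {..<n}. \<xi> i \<omega>} = {i. i < n \<and> \<xi> i \<omega>}" by auto
    then show "z ^ card {i. i < n \<and> \<xi> i \<omega>} = (\<Prod>i<n. if \<xi> i \<omega> then z else 1)"
      using prod.inter_filter[of "{..<n}" "\<lambda>_. z" "\<lambda>i. \<xi> i \<omega>"] by simp
  qed
  also have "\<dots> = (\<Prod>i<n. \<integral>\<omega>. (if \<xi> i \<omega> then z else 1) \<partial>M)"
  proof (rule indep_vars_lebesgue_integral)
    have "indep_vars (\<lambda>_. count_space UNIV) \<xi> {..<n}"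
      using indep by (rule indep_vars_subset) simp
    then show "indep_vars (\<lambda>_. borel) (\<lambda>i \<omega>. if \<xi> i \<omega> then z else 1) {..<n}"
      by (rule indep_vars_compose2[where Y = "\<lambda>_ b. if b then z else 1"]) simp
    show "integrable M (\<lambda>\<omega>. if \<xi> i \<omega> then z else 1)" for i
      by (rule integrable_const_bound[where B = "max \<bar>z\<bar> 1"]) auto
  qed simp
  also have "\<dots> = (\<Prod>i<n. 1 - p + p * z)"
  proof (rule prod.cong[OF refl])
    fix i
    have ev: "{\<omega> \<in> space M. \<xi> i \<omega>} \<in> events" by measurable
    have "(\<integral>\<omega>. (if \<xi> i \<omega> then z else 1) \<partial>M) =
        (\<integral>\<omega>. 1 + (z - 1) * indicator {\<omega> \<in> space M. \<xi> i \<omega>} \<omega> \<partial>M)"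
      by (intro Bochner_Integration.integral_cong) auto
    also have "\<dots> = 1 + (z - 1) * p"
      using ev p[of i] emeasure_finite[of "{\<omega> \<in> space M. \<xi> i \<omega>}"]
      by (subst Bochner_Integration.integral_add)
        (simp_all add: prob_space less_top[symmetric] Int_absorb2 subset_eq)
    finally show "(\<integral>\<omega>. (if \<xi> i \<omega> then z else 1) \<partial>M) = 1 - p + p * z"
      by (simp add: algebra_simps)
  qed
  finally show ?thesis by simp
qed

text \<open>
  The law of a random element \<open>C X\<close> of a family, with an independent index \<open>X\<close>, is the mixture of
  the laws of the \<open>C n\<close>. Pairwise independence of \<open>X\<close> from each single \<open>C n\<close> is all that enters,
  since one conditions on the value of \<open>X\<close>.
\<close>

lemma (in prob_space) law_random_index:
  fixes X Y :: "'a \<Rightarrow> nat" and C :: "nat \<Rightarrow> 'a \<Rightarrow> nat"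
  assumes X: "X \<in> measurable M (count_space UNIV)"
    and C: "\<And>n. C n \<in> measurable M (count_space UNIV)"
    and indep: "\<And>n k. prob {\<omega> \<in> space M. X \<omega> = n \<and> C n \<omega> = k} =
      prob {\<omega> \<in> space M. X \<omega> = n} * prob {\<omega> \<in> space M. C n \<omega> = k}"
    and Y: "\<And>\<omega>. \<omega> \<in> space M \<Longrightarrow> Y \<omega> = C (X \<omega>) \<omega>"
  shows "prob {\<omega> \<in> space M. Y \<omega> = k} = pmf (bind_pmf (law M X) (\<lambda>n. law M (C n))) k"
proof -
  note [measurable] = X C
  have "(\<lambda>n. prob {\<omega> \<in> space M. X \<omega> = n \<and> C n \<omega> = k}) sums
      prob (\<Union>n. {\<omega> \<in> space M. X \<omega> = n \<and> C n \<omega> = k})"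
    by (rule finite_measure_UNION) (auto simp: disjoint_family_on_def)
  also have "(\<Union>n. {\<omega> \<in> space M. X \<omega> = n \<and> C n \<omega> = k}) = {\<omega> \<in> space M. Y \<omega> = k}"
    using Y by auto
  finally have L: "(\<lambda>n. pmf (law M X) n * pmf (law M (C n)) k) sums prob {\<omega> \<in> space M. Y \<omega> = k}"
    by (simp add: indep pmf_law prob_space_axioms X C)
  have "integrable (density (count_space UNIV) (pmf (law M X))) (\<lambda>n. pmf (law M (C n)) k)"
    unfolding measure_pmf_eq_density[symmetric]
    by (rule measure_pmf.integrable_const_bound[where B = 1]) (auto simp: pmf_le_1)
  then have "integrable (count_space UNIV) (\<lambda>n. pmf (law M X) n * pmf (law M (C n)) k)"
    by (subst (asm) integrable_density) auto
  from sums_integral_count_space_nat[OF this]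
  have "(\<lambda>n. pmf (law M X) n * pmf (law M (C n)) k) sums
      pmf (bind_pmf (law M X) (\<lambda>n. law M (C n))) k"
    unfolding pmf_bind measure_pmf_eq_density by (subst integral_density) auto
  with L show ?thesis by (rule sums_unique2)
qed

lemma (in bell_touchard_process) pgf_decomposition:
  assumes dec: "decomposition M p N N\<^sub>1" and p: "0 \<le> p" "p \<le> 1" and t: "0 \<le> t"
  obtains P where "\<And>k. prob {\<omega> \<in> space M. N\<^sub>1 t \<omega> = k} = pmf P k"
    and "\<And>z. 0 \<le> z \<Longrightarrow> z \<le> 1 \<Longrightarrow> pgf P z = pgf (law M (N t)) (1 - p + p * z)"
proof -
  obtain \<xi> :: "nat \<Rightarrow> 'a \<Rightarrow> bool" where
    iid: "indep_vars (\<lambda>_. count_space UNIV) \<xi> UNIV"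
    and mark: "\<And>i. prob {\<omega> \<in> space M. \<xi> i \<omega>} = p"
    and indep: "indep_set
          (sigma_sets (space M) {{\<omega> \<in> space M. N s \<omega> \<in> A} | s A. 0 \<le> s})
          (sigma_sets (space M) (range (\<lambda>i. {\<omega> \<in> space M. \<xi> i \<omega>})))"
    and N1: "\<And>\<omega>. \<omega> \<in> space M \<Longrightarrow> N\<^sub>1 t \<omega> = card {i. i < N t \<omega> \<and> \<xi> i \<omega>}"
    using dec t unfolding decomposition_def by blast
  define C where "C n \<omega> = card {i. i < n \<and> \<xi> i \<omega>}" for n \<omega>
  \<comment> \<open>To use the independence of the two sigma-algebras, the counts \<open>C n\<close> must be measurable with
    respect to the one generated by the marks, not just with respect to \<open>M\<close>.\<close>
  define G where "G = sigma (space M) (range (\<lambda>i. {\<omega> \<in> space M. \<xi> i \<omega>}))"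
  have space_G: "space G = space M" by (simp add: G_def space_measure_of_conv)
  have sets_G: "sets G = sigma_sets (space M) (range (\<lambda>i. {\<omega> \<in> space M. \<xi> i \<omega>}))"
    unfolding G_def by (rule sets_measure_of) auto
  have [measurable]: "Measurable.pred G (\<xi> i)" for i
    unfolding pred_def space_G sets_G by (rule sigma_sets.Basic) auto
  have C_sum: "C n \<omega> = (\<Sum>i<n. if \<xi> i \<omega> then 1 else 0)" for n \<omega>
  proof -
    have "{i \<in> {..<n}. \<xi> i \<omega>} = {i. i < n \<and> \<xi> i \<omega>}" by auto
    then show ?thesis
      using sum.inter_filter[of "{..<n}" "\<lambda>_. 1::nat" "\<lambda>i. \<xi> i \<omega>"] by (simp add: C_def)
  qed
  have CG [measurable]: "C n \<in> measurable G (count_space UNIV)" for n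
    unfolding C_sum by measurable
  have C_ev: "{\<omega> \<in> space M. C n \<omega> = k} \<in> sets G" for n k
    using measurable_sets[OF CG, of "{k}" n] by (simp add: space_G vimage_def Int_def conj_commute)
  have "sets G \<subseteq> events" unfolding sets_G using indep_setD_ev2[OF indep] .
  then have CM: "C n \<in> measurable M (count_space UNIV)" for n
    using C_ev[of n] by (subst measurable_count_space_eq2_countable)
      (auto simp: vimage_def Int_def conj_commute)
  have "prob {\<omega> \<in> space M. N t \<omega> = n \<and> C n \<omega> = k} =
      prob {\<omega> \<in> space M. N t \<omega> = n} * prob {\<omega> \<in> space M. C n \<omega> = k}" for n k
  proof -
    have "{\<omega> \<in> space M. N t \<omega> = n} = {\<omega> \<in> space M. N t \<omega> \<in> {n}}" by simp
    then have "{\<omega> \<in> space M. N t \<omega> = n} \<in>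
        sigma_sets (space M) {{\<omega> \<in> space M. N s \<omega> \<in> A} | s A. 0 \<le> s}"
      using t by (intro sigma_sets.Basic) blast
    from indep_setD[OF indep this C_ev[unfolded sets_G, of n k]] show ?thesis
      by (simp add: Int_def conj_ac)
  qed
  then have "prob {\<omega> \<in> space M. N\<^sub>1 t \<omega> = k} =
      pmf (bind_pmf (law M (N t)) (\<lambda>n. law M (C n))) k" for k
    using N1 by (intro law_random_index measurable_N t CM) (auto simp: C_def)
  moreover have "pgf (bind_pmf (law M (N t)) (\<lambda>n. law M (C n))) z =
      pgf (law M (N t)) (1 - p + p * z)" if "0 \<le> z" "z \<le> 1" for z
  proof -
    have "pgf (law M (C n)) z = (1 - p + p * z) ^ n" for n
      using pgf_count_marks[OF iid mark CM[unfolded C_def]] by (simp add: C_def[abs_def])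
    then show ?thesis using that by (simp add: pgf_bind pgf_def[of "law M (N t)"])
  qed
  ultimately show ?thesis by (rule that)
qed

section \<open>Bell polynomials as coefficients\<close>

text \<open>
  By Dobinski's series, \<open>exp x\<close> times the left-hand side is the double sum of
  \<open>x\<^sup>j / j! (j y)\<^sup>k / k!\<close>. Summing over \<open>k\<close> first gives \<open>\<Sum>j. (x exp y)\<^sup>j / j! = exp (x exp y)\<close>;
  all terms are nonnegative, so the order of summation is immaterial.
\<close>

lemma bell_poly_exponential_sums:
  assumes x: "0 \<le> x" and y: "0 \<le> y"
  shows "(\<lambda>k. bell_poly k x * y ^ k / fact k) sums exp (x * (exp y - 1))"
proof -
  define f where "f = (\<lambda>(j::nat, k::nat). x ^ j / fact j * ((real j * y) ^ k / fact k))"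
  have exp_sum: "((\<lambda>k. u ^ k / fact k) has_sum exp u) UNIV" if "0 \<le> u" for u :: real
    using exp_converges[of u] that
    by (intro sums_nonneg_imp_has_sum) (auto simp: divide_inverse mult.commute)
  have inner: "((\<lambda>k. f (j, k)) has_sum (x * exp y) ^ j / fact j) UNIV" for j
  proof -
    have "((\<lambda>k. x ^ j / fact j * ((real j * y) ^ k / fact k)) has_sum
        x ^ j / fact j * exp (real j * y)) UNIV"
      using y by (intro has_sum_cmult_right exp_sum) simp
    then show ?thesis by (simp add: f_def power_mult_distrib exp_of_nat_mult)
  qed
  have outer: "((\<lambda>j. (x * exp y) ^ j / fact j) has_sum exp (x * exp y)) UNIV"
    using x by (intro exp_sum) simp
  have "f summable_on UNIV \<times> UNIV"
    using inner has_sum_imp_summable[OF outer] x y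
    by (intro summable_on_SigmaI[where g = "\<lambda>j. (x * exp y) ^ j / fact j"]) (auto simp: f_def)
  then have "(f has_sum exp (x * exp y)) (UNIV \<times> UNIV)"
    by (intro has_sum_SigmaI[OF inner outer])
  then have swapped: "((\<lambda>(k, j). f (j, k)) has_sum exp (x * exp y)) (UNIV \<times> UNIV)"
    by (subst (asm) has_sum_swap)
  have "((\<lambda>j. f (j, k)) has_sum exp x * bell_poly k x * y ^ k / fact k) UNIV" for k
  proof -
    let ?c = "y ^ k / fact k" and ?b = "\<lambda>j. real j ^ k / fact j * x ^ j"
    have f: "f (j, k) = ?c * ?b j" for j
      by (simp add: f_def power_mult_distrib mult_ac)
    have "(\<lambda>j. f (j, k)) summable_on UNIV"
      using summable_on_SigmaD1[of "\<lambda>k j. f (j, k)" UNIV "\<lambda>_. UNIV" k]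
        has_sum_imp_summable[OF swapped] by simp
    from sums_summable[OF has_sum_imp_sums[OF has_sum_infsum[OF this]]]
    have "summable (\<lambda>j. ?c * ?b j)" by (simp only: f)
    then have "(\<lambda>j. ?c * ?b j) sums (?c * (\<Sum>j. ?b j))"
    proof (cases "?c = 0")
      case False
      then show ?thesis
        using \<open>summable (\<lambda>j. ?c * ?b j)\<close> by (intro sums_mult summable_sums) (simp only: summable_cmult_iff, simp)
    qed (simp only: mult_zero_left sums_zero)
    then have "((\<lambda>j. f (j, k)) has_sum (?c * (\<Sum>j. ?b j))) UNIV"
      by (simp only: f) (rule sums_nonneg_imp_has_sum, use x y in auto)
    moreover have "?c * (\<Sum>j. ?b j) = exp x * bell_poly k x * y ^ k / fact k"
      by (simp add: bell_poly_def exp_minus)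
    ultimately show ?thesis by (simp only:)
  qed
  then have "((\<lambda>k. exp x * bell_poly k x * y ^ k / fact k) has_sum exp (x * exp y)) UNIV"
    using swapped by (intro has_sum_SigmaD[OF swapped]) auto
  from sums_mult[OF has_sum_imp_sums[OF this], of "exp (- x)"] show ?thesis
    by (simp add: exp_minus field_simps exp_diff)
qed

theorem theorem3p2:
  fixes M :: "'a measure" and N N\<^sub>1 :: "real \<Rightarrow> 'a \<Rightarrow> nat"
    and \<alpha> \<theta> p t :: real and k :: nat
  assumes "0 < \<alpha>" and "0 < \<theta>" and "0 < p" and "p < 1"
    and "bell_touchard_process M N \<alpha> \<theta>"
    and "decomposition M p N N\<^sub>1"
    and "0 \<le> t"
  shows "measure M {\<omega> \<in> space M. N\<^sub>1 t \<omega> = k} =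
    (let \<theta>' = exp ((1 - p) * \<theta>) in
      (p * \<theta>) ^ k / fact k * exp (- \<alpha> * t * \<theta>' * (exp (p * \<theta>) - 1))
        * bell_poly k (\<alpha> * t * \<theta>'))"
proof -
  interpret bell_touchard_process M N \<alpha> \<theta> by fact
  define x where "x = \<alpha> * t * exp ((1 - p) * \<theta>)"
  define A where "A = exp (- (x * (exp (p * \<theta>) - 1)))"
  have x: "0 \<le> x" using assms by (simp add: x_def)
  obtain P where P: "\<And>k. prob {\<omega> \<in> space M. N\<^sub>1 t \<omega> = k} = pmf P k"
    and pgf: "\<And>z. 0 \<le> z \<Longrightarrow> z \<le> 1 \<Longrightarrow> pgf P z = pgf (law M (N t)) (1 - p + p * z)"
    using pgf_decomposition[OF assms(6) _ _ assms(7)] assms(3,4) by (metis less_imp_le)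
  have "pmf P = (\<lambda>k. A * (bell_poly k x * (p * \<theta>) ^ k / fact k))"
  proof (rule power_series_unique)
    fix z :: real
    assume z: "0 < z" "z < 1"
    then show "(\<lambda>k. pmf P k * z ^ k) sums pgf P z" by (intro pgf_sums) simp
    have "p * z < p" using z assms by simp
    then have "pgf P z = exp (\<alpha> * t * (exp (\<theta> * (1 - p + p * z)) - exp \<theta>))"
      using z assms by (subst pgf) (auto intro!: pgf_process)
    also have "\<theta> * (1 - p + p * z) = (1 - p) * \<theta> + p * \<theta> * z" by (simp add: algebra_simps)
    also have "exp \<theta> = exp ((1 - p) * \<theta>) * exp (p * \<theta>)"
      by (simp add: exp_add[symmetric] algebra_simps)
    finally have "pgf P z = A * exp (x * (exp (p * \<theta> * z) - 1))"
      by (simp add: A_def x_def exp_add algebra_simps flip: exp_add)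
    then show "(\<lambda>k. A * (bell_poly k x * (p * \<theta>) ^ k / fact k) * z ^ k) sums pgf P z"
      using sums_mult[OF bell_poly_exponential_sums[OF x, of "p * \<theta> * z"], of A] z assms
      by (simp add: power_mult_distrib mult_ac)
  qed
  then show ?thesis
    by (simp add: P Let_def A_def x_def mult_ac)
qed

end
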